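(* Let $f:\mathbb{R}^d\to\mathbb{R}\cup\{\infty\}$ be $\ell$-smooth. Then for all $x,y\in\mathcal{X}$ such that $\|y-x\|\in[0,q_{\max}(\|\nabla f(x)\|))$, $$f(y)\le f(x)+\langle\nabla f(x),y-x\rangle+\int_0^{\|y-x\|}q^{-1}(\tau;\|\nabla f(x)\|)\,d\tau.$$
   Context: Norms are Euclidean for vectors and spectral for matrices. For $f:\mathbb{R}^d\to\mathbb{R}\cup\{\infty\}$ put $\mathcal{X}=\{x\in\mathbb{R}^d: f(x)<\infty\}$, assumed to be open and convex. $f$ is $\ell$-smooth if $f$ is twice differentiable on $\mathcal{X}$, $f$ is continuous on the closure of $\mathcal{X}$ (as a map into $\mathbb{R}\cup\{\infty\}$), and $\ell:[0,\infty)\to(0,\infty)$ is a non-decreasing positive locally Lipschitz function such that $\|\nabla^2f(x)\|\le\ell(\|\nabla f(x)\|)$ for all $x\in\mathcal{X}$. For $a\ge0$ define $q(s;a)=\int_0^s\frac{dv}{\ell(a+v)}$ for $s\ge0$ and $q_{\max}(a)=\int_0^\infty\frac{dv}{\ell(a+v)}\in(0,\infty]$. For fixed $a$, $q(\cdot;a)$ is a strictly increasing bijection $[0,\infty)\to[0,q_{\max}(a))$, and $q^{-1}(\cdot;a):[0,q_{\max}(a))\to[0,\infty)$ denotes its inverse. *)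

theory Defs
  imports "HOL-Analysis.Analysis"
begin

definition eff_domain :: "('a \<Rightarrow> ereal) \<Rightarrow> 'a set" where
  "eff_domain f = {x. f x < \<infinity>}"

text \<open>
  Functions into \<open>\<real> \<union> {\<infinity>}\<close> are \<^typ>\<open>ereal\<close>-valued functions avoiding \<open>-\<infinity>\<close>. Derivatives are taken of the
  finite-valued \<open>real_of_ereal \<circ> f\<close>; the junk value of \<open>real_of_ereal\<close> at \<open>\<infinity>\<close> is irrelevant at interior
  points of the effective domain.
\<close>

definition gradient :: "(real ^ 'n \<Rightarrow> ereal) \<Rightarrow> real ^ 'n \<Rightarrow> real ^ 'n" where
  "gradient f x = (THE D. GDERIV (real_of_ereal \<circ> f) x :> D)"

definition hessian :: "(real ^ 'n \<Rightarrow> ereal) \<Rightarrow> real ^ 'n \<Rightarrow> real ^ 'n ^ 'n" where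
  "hessian f x = matrix (frechet_derivative (gradient f) (at x))"

text \<open>The norm of the type \<^typ>\<open>real ^ 'n ^ 'n\<close> is the Frobenius norm, so the spectral norm is the
  operator norm of the induced linear map.\<close>

definition spectral_norm :: "real ^ 'n ^ 'm \<Rightarrow> real" where
  "spectral_norm A = onorm ((*v) A)"

definition twice_differentiable_on :: "(real ^ 'n \<Rightarrow> ereal) \<Rightarrow> (real ^ 'n) set \<Rightarrow> bool" where
  "twice_differentiable_on f S \<longleftrightarrow>
     (\<forall>x\<in>S. (real_of_ereal \<circ> f) differentiable (at x) \<and> gradient f differentiable (at x))"

definition locally_lipschitz_on :: "real set \<Rightarrow> (real \<Rightarrow> real) \<Rightarrow> bool" where
  "locally_lipschitz_on S g \<longleftrightarrow>
     (\<forall>x\<in>S. \<exists>u>0. \<exists>L. L-lipschitz_on (cball x u \<inter> S) g)"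

text \<open>Only the values of \<open>l\<close> on \<open>[0, \<infinity>)\<close> are constrained, and only these matter.\<close>

definition ell_smooth :: "(real \<Rightarrow> real) \<Rightarrow> (real ^ 'n \<Rightarrow> ereal) \<Rightarrow> bool" where
  "ell_smooth l f \<longleftrightarrow>
     twice_differentiable_on f (eff_domain f) \<and>
     continuous_on (closure (eff_domain f)) f \<and>
     mono_on {0..} l \<and>
     (\<forall>s\<ge>0. l s > 0) \<and>
     locally_lipschitz_on {0..} l \<and>
     (\<forall>x\<in>eff_domain f. spectral_norm (hessian f x) \<le> l (norm (gradient f x)))"

definition q :: "(real \<Rightarrow> real) \<Rightarrow> real \<Rightarrow> real \<Rightarrow> real" where
  "q l a s = integral {0..s} (\<lambda>v. 1 / l (a + v))"

definition q_max :: "(real \<Rightarrow> real) \<Rightarrow> real \<Rightarrow> ennreal" where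
  "q_max l a = (\<integral>\<^sup>+ v\<in>{0..}. ennreal (1 / l (a + v)) \<partial>lborel)"

text \<open>The inverse of \<open>q l a\<close> as a map from \<open>[0, \<infinity>)\<close> onto \<open>[0, q_max l a)\<close>; unspecified outside that interval.\<close>

definition q_inv :: "(real \<Rightarrow> real) \<Rightarrow> real \<Rightarrow> real \<Rightarrow> real" where
  "q_inv l a = the_inv_into {0..} (q l a)"

end

theory Submission
  imports Defs
begin

text \<open>
  Move from \<open>x\<close> to \<open>y\<close> at unit speed along the direction \<open>e = (y - x) / norm (y - x)\<close> and
  record the change \<open>v(t) = \<nabla>f(x + t e) - \<nabla>f(x)\<close> of the gradient. With \<open>a = norm (\<nabla>f(x))\<close>,
  the Hessian bound and the monotonicity of \<open>l\<close> give \<open>norm (v'(t)) \<le> l (a + norm (v(t)))\<close>, so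
  \<open>norm v\<close> is a subsolution of the scalar equation \<open>z' = l (a + z)\<close>, \<open>z(0) = 0\<close>. The function
  \<open>q l a\<close> is the time that the solution of this equation needs to reach a given height: it
  straightens the equation to \<open>(q l a \<circ> z)' = 1\<close>. Hence \<open>q l a (norm (v t)) \<le> t\<close>
  (\<open>escape_time_bound\<close>), that is, \<open>norm (v t) \<le> q_inv l a t\<close>.

  By the Cauchy-Schwarz inequality the derivative of \<open>t \<mapsto> f(x + t e) - t \<langle>\<nabla>f(x), e\<rangle>\<close>, which is
  \<open>\<langle>v(t), e\<rangle>\<close>, is at most \<open>q_inv l a t\<close>, and integrating over \<open>[0, norm (y - x)]\<close> gives the
  claim. The condition \<open>norm (y - x) < q_max l a\<close> says that the scalar solution does not blow up
  before time \<open>norm (y - x)\<close>; it makes \<open>q_inv l a\<close> a genuine continuous inverse on the interval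
  of integration (\<open>q_inv_on_interval\<close>).
\<close>

section \<open>The escape time and its inverse\<close>

lemma locally_lipschitz_on_imp_continuous_on:
  assumes "locally_lipschitz_on S g"
  shows "continuous_on S g"
proof (rule continuous_on_eq_continuous_within[THEN iffD2], rule ballI)
  fix x assume x: "x \<in> S"
  then obtain u L where u: "u > 0" and L: "L-lipschitz_on (cball x u \<inter> S) g"
    using assms unfolding locally_lipschitz_on_def by blast
  have "continuous (at x within cball x u \<inter> S) g"
    using lipschitz_on_continuous_within[OF L] x u by auto
  moreover have "at x within cball x u \<inter> S = at x within S"
    by (rule at_within_nhd[of _ "ball x u"]) (use u in auto)
  ultimately show "continuous (at x within S) g" by simp
qed

context
  fixes l :: "real \<Rightarrow> real" and a :: real
  assumes l_cont: "continuous_on {0..} l"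
    and l_pos: "\<And>s. s \<ge> 0 \<Longrightarrow> l s > 0"
    and a_nonneg: "a \<ge> 0"
begin

lemma continuous_on_inverse_shift: "continuous_on {0..} (\<lambda>v. 1 / l (a + v))"
proof -
  have "continuous_on {0..} (\<lambda>v. l (a + v))"
    by (rule continuous_on_compose2[OF l_cont]) (use a_nonneg in \<open>auto intro!: continuous_intros\<close>)
  moreover have "l (a + v) \<noteq> 0" if "v \<in> {0..}" for v
    using l_pos[of "a + v"] a_nonneg that by auto
  ultimately show ?thesis
    by (intro continuous_intros) auto
qed

lemma q_zero: "q l a 0 = 0"
  by (simp add: q_def)

lemma q_has_derivative_within:
  assumes "0 \<le> s" "s \<le> b"
  shows "(q l a has_real_derivative 1 / l (a + s)) (at s within {0..b})"
  unfolding q_def[abs_def]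
  by (rule integral_has_real_derivative)
    (use assms in \<open>auto intro: continuous_on_subset[OF continuous_on_inverse_shift]\<close>)

lemma q_has_derivative:
  assumes "0 < s"
  shows "(q l a has_real_derivative 1 / l (a + s)) (at s)"
  using q_has_derivative_within[of s "s + 1"] assms at_within_Icc_at[of 0 s "s + 1"] by simp

lemma q_continuous_on: "continuous_on {0..} (q l a)"
proof (rule continuous_on_eq_continuous_within[THEN iffD2], rule ballI)
  fix s :: real assume s: "s \<in> {0..}"
  have "continuous (at s within {0..s+1}) (q l a)"
    using q_has_derivative_within[of s "s + 1"] s by (auto intro: DERIV_continuous)
  moreover have "at s within {0..s+1} = at s within {0..}"
    by (rule at_within_nhd[of _ "{..<s+1}"]) (use s in auto)
  ultimately show "continuous (at s within {0..}) (q l a)" by simp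
qed

lemma q_strict_mono_on: "strict_mono_on {0..} (q l a)"
proof (rule strict_mono_onI)
  fix r s :: real assume rs: "r \<in> {0..}" "s \<in> {0..}" "r < s"
  show "q l a r < q l a s"
  proof (rule DERIV_pos_imp_increasing_open[OF \<open>r < s\<close>])
    show "\<exists>d. (q l a has_real_derivative d) (at z) \<and> 0 < d" if "r < z" "z < s" for z
      using q_has_derivative[of z] l_pos[of "a + z"] a_nonneg rs that
      by (intro exI[of _ "1 / l (a + z)"]) auto
    show "continuous_on {r..s} (q l a)"
      by (rule continuous_on_subset[OF q_continuous_on]) (use rs in auto)
  qed
qed

lemma q_inv_q: "0 \<le> s \<Longrightarrow> q_inv l a (q l a s) = s"
  unfolding q_inv_def
  by (rule the_inv_into_f_f) (auto intro: strict_mono_on_imp_inj_on q_strict_mono_on)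

lemma nn_integral_eq_q:
  assumes "0 \<le> s"
  shows "(\<integral>\<^sup>+ v\<in>{0..s}. ennreal (1 / l (a + v)) \<partial>lborel) = ennreal (q l a s)"
proof -
  let ?k = "\<lambda>v. 1 / l (a + v)"
  have cont: "continuous_on {0..s} ?k"
    by (rule continuous_on_subset[OF continuous_on_inverse_shift]) auto
  have nonneg: "0 \<le> ?k v" if "v \<in> {0..s}" for v
    using l_pos[of "a + v"] a_nonneg that by auto
  have "((\<lambda>v. ?k v) has_integral q l a s) {0..s}"
    unfolding q_def by (rule integrable_integral[OF integrable_continuous_real[OF cont]])
  then have "(\<integral>\<^sup>+ v. ennreal (?k v) * indicator {0..s} v \<partial>lborel) = ennreal (q l a s)"
    by (intro nn_integral_has_integral_lebesgue' nonneg)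
  then show ?thesis by simp
qed

text \<open>Monotone convergence: the improper integral \<open>q_max l a\<close> is the supremum of \<open>q l a\<close>.\<close>

lemma q_exceeds_below_q_max:
  assumes "ennreal r < q_max l a"
  obtains s where "0 \<le> s" "r < q l a s"
proof -
  let ?k = "\<lambda>v. 1 / l (a + v)"
  let ?g = "\<lambda>(n::nat) v. ennreal (?k v) * indicator {0..real n} v"
  have meas: "?g n \<in> borel_measurable lborel" for n
  proof -
    have "continuous_on {0..real n} ?k"
      by (rule continuous_on_subset[OF continuous_on_inverse_shift]) auto
    then have "(\<lambda>v. indicator {0..real n} v *\<^sub>R ?k v) \<in> borel_measurable borel"
      by (intro borel_measurable_continuous_on_indicator) auto
    then have "(\<lambda>v. ennreal (indicator {0..real n} v *\<^sub>R ?k v)) \<in> borel_measurable lborel"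
      by simp
    also have "(\<lambda>v. ennreal (indicator {0..real n} v *\<^sub>R ?k v)) = ?g n"
      by (auto simp: indicator_def)
    finally show ?thesis .
  qed
  have inc: "incseq ?g"
    by (auto simp: incseq_def le_fun_def indicator_def)
  have sup: "(SUP n. ?g n v) = ennreal (?k v) * indicator {0..} v" for v
  proof (rule antisym)
    show "(SUP n. ?g n v) \<le> ennreal (?k v) * indicator {0..} v"
      by (rule SUP_least) (auto simp: indicator_def)
    obtain n where "v \<le> real n" using real_arch_simple by blast
    then have "ennreal (?k v) * indicator {0..} v \<le> ?g n v"
      by (auto simp: indicator_def)
    then show "ennreal (?k v) * indicator {0..} v \<le> (SUP n. ?g n v)"
      by (rule order_trans) (rule SUP_upper, simp)
  qed
  have "q_max l a = (\<integral>\<^sup>+ v. (SUP n. ?g n v) \<partial>lborel)"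
    unfolding q_max_def sup ..
  also have "\<dots> = (SUP n. \<integral>\<^sup>+ v. ?g n v \<partial>lborel)"
    by (rule nn_integral_monotone_convergence_SUP[OF inc meas])
  also have "\<dots> = (SUP n::nat. ennreal (q l a (real n)))"
    by (simp add: nn_integral_eq_q)
  finally obtain n :: nat where "ennreal r < ennreal (q l a (real n))"
    using assms by (auto simp: less_SUP_iff)
  then have "r < q l a (real n)"
    by (metis ennreal_leI not_less)
  then show ?thesis using that[of "real n"] by simp
qed

lemma q_inv_on_interval:
  assumes "ennreal r < q_max l a"
  shows "continuous_on {0..r} (q_inv l a)"
    and "\<And>\<tau>. 0 \<le> \<tau> \<Longrightarrow> \<tau> \<le> r \<Longrightarrow> 0 \<le> q_inv l a \<tau> \<and> q l a (q_inv l a \<tau>) = \<tau>"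
proof -
  obtain b where b: "0 \<le> b" "r < q l a b"
    using q_exceeds_below_q_max[OF assms] .
  have cont: "continuous_on {0..b} (q l a)"
    by (rule continuous_on_subset[OF q_continuous_on]) auto
  have ex: "\<exists>s. 0 \<le> s \<and> s \<le> b \<and> q l a s = \<tau>" if "0 \<le> \<tau>" "\<tau> \<le> r" for \<tau>
    by (rule IVT') (use that b cont q_zero in auto)
  have "continuous_on (q l a ` {0..b}) (q_inv l a)"
    by (rule continuous_on_inv[OF cont]) (auto simp: q_inv_q)
  moreover have "{0..r} \<subseteq> q l a ` {0..b}"
  proof
    fix \<tau> assume "\<tau> \<in> {0..r}"
    then obtain s where "0 \<le> s" "s \<le> b" "q l a s = \<tau>" using ex by auto
    then show "\<tau> \<in> q l a ` {0..b}" by auto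
  qed
  ultimately show "continuous_on {0..r} (q_inv l a)"
    by (rule continuous_on_subset)
  show "0 \<le> q_inv l a \<tau> \<and> q l a (q_inv l a \<tau>) = \<tau>" if "0 \<le> \<tau>" "\<tau> \<le> r" for \<tau>
    using ex[OF that] q_inv_q by auto
qed

section \<open>Comparison with the scalar differential equation\<close>

text \<open>
  Away from the zeros of \<open>v\<close> the chain rule gives
  \<open>(q l a \<circ> norm \<circ> v)' = \<langle>v, v'\<rangle> / (norm v * l (a + norm v)) \<le> 1\<close>.
  The norm may fail to be differentiable where \<open>v\<close> vanishes, so the mean value theorem is applied
  only after the last zero \<open>t0\<close> of \<open>v\<close> in \<open>[0, t]\<close>, which yields the sharper bound \<open>t - t0\<close>.
\<close>

lemma escape_time_bound:
  fixes v v' :: "real \<Rightarrow> 'b::real_inner"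
  assumes t: "0 \<le> t" and v0: "v 0 = 0"
    and deriv: "\<And>s. 0 \<le> s \<Longrightarrow> s \<le> t \<Longrightarrow> (v has_vector_derivative v' s) (at s)"
    and bound: "\<And>s. 0 \<le> s \<Longrightarrow> s \<le> t \<Longrightarrow> norm (v' s) \<le> l (a + norm (v s))"
  shows "q l a (norm (v t)) \<le> t"
proof -
  have cont: "continuous_on {0..t} v"
  proof (intro continuous_at_imp_continuous_on ballI)
    show "isCont v s" if "s \<in> {0..t}" for s
      using has_vector_derivative_continuous[OF deriv[of s]] that by simp
  qed
  define Z where "Z = {s \<in> {0..t}. v s = 0}"
  have "compact Z"
  proof -
    have "closed ({0..t} \<inter> v -` {0})"
      by (rule continuous_closed_preimage[OF cont]) auto
    moreover have "Z = {0..t} \<inter> v -` {0}" by (auto simp: Z_def)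
    ultimately have "closed Z" by simp
    moreover have "bounded Z"
      by (rule bounded_subset[of "{0..t}"]) (auto simp: Z_def)
    ultimately show ?thesis by (simp add: compact_eq_bounded_closed)
  qed
  moreover have "Z \<noteq> {}" using t v0 by (auto simp: Z_def)
  ultimately obtain t0 where t0: "t0 \<in> Z" and last: "\<And>s. s \<in> Z \<Longrightarrow> s \<le> t0"
    using compact_attains_sup[of Z] by blast
  have nz: "v s \<noteq> 0" if "t0 < s" "s \<le> t" for s
    using last[of s] that t0 by (auto simp: Z_def)
  show ?thesis
  proof (cases "t0 = t")
    case True
    then show ?thesis using t0 t q_zero by (auto simp: Z_def)
  next
    case False
    then have t0t: "0 \<le> t0" "t0 < t" using t0 by (auto simp: Z_def)
    let ?p = "\<lambda>s. q l a (norm (v s))"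
    let ?p' = "\<lambda>s. 1 / l (a + norm (v s)) * (v s \<bullet> v' s / norm (v s))"
    have cont_p: "continuous_on {t0..t} ?p"
      by (rule continuous_on_compose2[OF q_continuous_on])
        (use cont t0t in \<open>auto intro!: continuous_intros elim: continuous_on_subset\<close>)
    have deriv_p: "(?p has_real_derivative ?p' s) (at s)" if "t0 < s" "s < t" for s
    proof -
      have vs: "v s \<noteq> 0" using nz that by simp
      have "(v has_derivative (\<lambda>h. h *\<^sub>R v' s)) (at s)"
        using deriv[of s] that t0t by (simp add: has_vector_derivative_def)
      from has_derivative_compose[OF this has_derivative_norm[OF vs]]
      have "((\<lambda>s. norm (v s)) has_real_derivative (v s \<bullet> v' s / norm (v s))) (at s)"
        unfolding has_field_derivative_def
        by (rule has_derivative_eq_rhs)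
          (auto simp: fun_eq_iff sgn_div_norm inner_commute field_simps)
      from DERIV_chain2[OF q_has_derivative this] vs show ?thesis by simp
    qed
    have p'_le: "?p' s \<le> 1" if "t0 < s" "s < t" for s
    proof -
      have vs: "norm (v s) > 0" using nz that by simp
      have ls: "l (a + norm (v s)) > 0" using l_pos a_nonneg by simp
      have "v s \<bullet> v' s \<le> norm (v s) * norm (v' s)" by (rule norm_cauchy_schwarz)
      also have "\<dots> \<le> norm (v s) * l (a + norm (v s))"
        using bound[of s] that t0t by (intro mult_left_mono) auto
      finally show ?thesis using vs ls by (simp add: field_simps)
    qed
    obtain s where s: "t0 < s" "s < t" and mvt: "?p t - ?p t0 = (t - t0) * ?p' s"
    proof -
      have "\<exists>d s. t0 < s \<and> s < t \<and> DERIV ?p s :> d \<and> ?p t - ?p t0 = (t - t0) * d"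
        by (rule MVT[OF t0t(2) cont_p])
          (use deriv_p in \<open>auto simp: real_differentiable_def\<close>)
      then show ?thesis using that deriv_p DERIV_unique by metis
    qed
    have "?p t - ?p t0 \<le> t - t0"
      unfolding mvt by (rule mult_left_le[OF p'_le[OF s]]) (use t0t in simp)
    moreover have "?p t0 = 0" using t0 q_zero by (simp add: Z_def)
    ultimately show ?thesis using t0t by simp
  qed
qed

lemma norm_le_q_inv:
  fixes v v' :: "real \<Rightarrow> 'b::real_inner"
  assumes t: "0 \<le> t" "ennreal t < q_max l a" and v0: "v 0 = 0"
    and deriv: "\<And>s. 0 \<le> s \<Longrightarrow> s \<le> t \<Longrightarrow> (v has_vector_derivative v' s) (at s)"
    and bound: "\<And>s. 0 \<le> s \<Longrightarrow> s \<le> t \<Longrightarrow> norm (v' s) \<le> l (a + norm (v s))"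
  shows "norm (v t) \<le> q_inv l a t"
proof -
  have "q l a (norm (v t)) \<le> q l a (q_inv l a t)"
    using escape_time_bound[of t v v'] q_inv_on_interval(2)[OF t(2), of t] assms by simp
  then show ?thesis
    using strict_mono_on_less_eq[OF q_strict_mono_on, of "norm (v t)" "q_inv l a t"]
      q_inv_on_interval(2)[OF t(2), of t] t by simp
qed

end

section \<open>Gradient and Hessian\<close>

lemma GDERIV_gradient:
  fixes f :: "real ^ 'n \<Rightarrow> ereal"
  assumes "(real_of_ereal \<circ> f) differentiable (at z)"
  shows "GDERIV (real_of_ereal \<circ> f) z :> gradient f z"
proof -
  obtain D where D: "((real_of_ereal \<circ> f) has_derivative D) (at z)"
    using assms by (auto simp: differentiable_def)
  \<comment> \<open>The Riesz representative of the linear functional \<open>D\<close> is the value of its adjoint at \<open>1\<close>.\<close>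
  have "D = (\<lambda>h. h \<bullet> adjoint D 1)"
    using adjoint_works[OF has_derivative_linear[OF D], of _ 1] by (auto simp: inner_commute)
  then have "GDERIV (real_of_ereal \<circ> f) z :> adjoint D 1"
    using D by (simp add: gderiv_def)
  moreover have "d = d'" if "GDERIV (real_of_ereal \<circ> f) z :> d" "GDERIV (real_of_ereal \<circ> f) z :> d'"
    for d d'
    using has_derivative_unique[of _ "\<lambda>h. h \<bullet> d" z "\<lambda>h. h \<bullet> d'"] that
    unfolding gderiv_def by (metis vector_eq_ldot)
  ultimately show ?thesis
    unfolding gradient_def by (metis theI)
qed

lemma gradient_has_derivative_hessian:
  fixes f :: "real ^ 'n \<Rightarrow> ereal"
  assumes "gradient f differentiable (at z)"
  shows "(gradient f has_derivative (\<lambda>h. hessian f z *v h)) (at z)"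
proof -
  have "(gradient f has_derivative frechet_derivative (gradient f) (at z)) (at z)"
    using assms by (simp add: frechet_derivative_works)
  moreover from this have "linear (frechet_derivative (gradient f) (at z))"
    by (rule has_derivative_linear)
  ultimately show ?thesis
    by (simp add: hessian_def matrix_works)
qed

lemma norm_mult_le_spectral_norm:
  fixes A :: "real ^ 'n ^ 'm"
  shows "norm (A *v h) \<le> spectral_norm A * norm h"
  unfolding spectral_norm_def
  by (rule onorm) (simp add: linear_conv_bounded_linear[symmetric])

section \<open>The descent inequality\<close>

lemma gradient_change_le_q_inv:
  fixes f :: "real ^ 'n \<Rightarrow> ereal"
  assumes smooth: "ell_smooth l f" and e: "norm e = 1" and t: "0 \<le> t"
    and tmax: "ennreal t < q_max l (norm (gradient f x))"
    and segment: "\<And>s. 0 \<le> s \<Longrightarrow> s \<le> t \<Longrightarrow> x + s *\<^sub>R e \<in> eff_domain f"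
  shows "norm (gradient f (x + t *\<^sub>R e) - gradient f x) \<le> q_inv l (norm (gradient f x)) t"
proof -
  define c where "c = (\<lambda>s. x + s *\<^sub>R e)"
  define v where "v = (\<lambda>s. gradient f (c s) - gradient f x)"
  have mono: "mono_on {0..} l" and pos: "\<And>s. s \<ge> 0 \<Longrightarrow> l s > 0"
    and cont: "continuous_on {0..} l"
    and hess: "\<And>z. z \<in> eff_domain f \<Longrightarrow> spectral_norm (hessian f z) \<le> l (norm (gradient f z))"
    and diff: "\<And>z. z \<in> eff_domain f \<Longrightarrow> gradient f differentiable (at z)"
    using smooth locally_lipschitz_on_imp_continuous_on
    by (auto simp: ell_smooth_def twice_differentiable_on_def)
  have "norm (v t) \<le> q_inv l (norm (gradient f x)) t"
  proof (rule norm_le_q_inv[OF cont pos norm_ge_zero t tmax])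
    show "v 0 = 0" by (simp add: v_def c_def)
    fix s assume s: "0 \<le> s" "s \<le> t"
    have dom: "c s \<in> eff_domain f" using segment s by (simp add: c_def)
    have "(c has_derivative (\<lambda>h. h *\<^sub>R e)) (at s)"
      unfolding c_def by (auto intro!: derivative_eq_intros)
    from has_derivative_compose[OF this gradient_has_derivative_hessian[OF diff[OF dom]]]
    show "(v has_vector_derivative hessian f (c s) *v e) (at s)"
      unfolding v_def has_vector_derivative_def
      by (auto intro!: derivative_eq_intros simp: matrix_vector_mult_scaleR)
    have "norm (hessian f (c s) *v e) \<le> l (norm (gradient f (c s)))"
      using norm_mult_le_spectral_norm[of "hessian f (c s)" e] hess[OF dom] e by simp
    also have "norm (gradient f (c s)) \<le> norm (gradient f x) + norm (v s)"
      unfolding v_def by (metis add.commute diff_add_cancel norm_triangle_ineq)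
    then have "l (norm (gradient f (c s))) \<le> l (norm (gradient f x) + norm (v s))"
      by (intro mono_onD[OF mono]) auto
    finally show "norm (hessian f (c s) *v e) \<le> l (norm (gradient f x) + norm (v s))" .
  qed
  then show ?thesis by (simp add: v_def c_def)
qed

theorem lemma4p5:
  fixes f :: "real ^ 'n \<Rightarrow> ereal" and l :: "real \<Rightarrow> real" and x y :: "real ^ 'n"
  assumes "\<And>z. f z \<noteq> -\<infinity>"
    and "open (eff_domain f)"
    and "convex (eff_domain f)"
    and "ell_smooth l f"
    and "x \<in> eff_domain f"
    and "y \<in> eff_domain f"
    and "ennreal (norm (y - x)) < q_max l (norm (gradient f x))"
  shows "f y \<le> f x + ereal (gradient f x \<bullet> (y - x)
           + integral {0..norm (y - x)} (\<lambda>\<tau>. q_inv l (norm (gradient f x)) \<tau>))"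
proof (cases "x = y")
  case True
  then show ?thesis by (simp add: zero_ereal_def[symmetric])
next
  case False
  define F where "F = real_of_ereal \<circ> f"
  define r where "r = norm (y - x)"
  define e where "e = (y - x) /\<^sub>R r"
  define a where "a = norm (gradient f x)"
  define c where "c = (\<lambda>t. x + t *\<^sub>R e)"
  have r: "r > 0" and e: "norm e = 1" and re: "y - x = r *\<^sub>R e"
    using False by (auto simp: r_def e_def)
  have ends: "c 0 = x" "c r = y"
    using re by (auto simp: c_def algebra_simps)
  have f_real: "f z = ereal (F z)" if "z \<in> eff_domain f" for z
    using assms(1)[of z] that by (cases "f z") (auto simp: eff_domain_def F_def)
  have dom: "c t \<in> eff_domain f" if "0 \<le> t" "t \<le> r" for t
  proof -
    have "c t = (1 - t / r) *\<^sub>R x + (t / r) *\<^sub>R y"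
      using r by (simp add: c_def e_def algebra_simps divide_inverse)
    then show ?thesis
      using convexD_alt[OF assms(3,5,6), of "t / r"] that r by simp
  qed
  have diffF: "GDERIV F z :> gradient f z" and diffG: "gradient f differentiable (at z)"
    if "z \<in> eff_domain f" for z
    using assms(4) GDERIV_gradient[of f z] that
    by (auto simp: ell_smooth_def twice_differentiable_on_def F_def)
  define \<phi> where "\<phi> = (\<lambda>t. F (c t) - t * (gradient f x \<bullet> e))"
  define \<phi>' where "\<phi>' = (\<lambda>t. (gradient f (c t) - gradient f x) \<bullet> e)"
  have \<phi>_deriv: "(\<phi> has_vector_derivative \<phi>' t) (at t within {0..r})" if "0 \<le> t" "t \<le> r" for t
  proof -
    have "(c has_derivative (\<lambda>h. h *\<^sub>R e)) (at t)"
      unfolding c_def by (auto intro!: derivative_eq_intros)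
    from has_derivative_compose[OF this diffF[OF dom[OF that], unfolded gderiv_def]]
    have "((\<lambda>t. F (c t)) has_derivative (\<lambda>h. h * (gradient f (c t) \<bullet> e))) (at t)"
      by (simp add: inner_commute)
    then have "(\<phi> has_derivative (\<lambda>h. h *\<^sub>R \<phi>' t)) (at t)"
      unfolding \<phi>_def \<phi>'_def
      by (auto intro!: derivative_eq_intros simp: inner_diff_left algebra_simps)
    then show ?thesis
      by (simp add: has_vector_derivative_def has_derivative_at_withinI)
  qed
  have \<phi>_int: "(\<phi>' has_integral (\<phi> r - \<phi> 0)) {0..r}"
    by (rule fundamental_theorem_of_calculus) (use r \<phi>_deriv in auto)
  have tmax: "ennreal t < q_max l a" if "t \<le> r" for t
    using le_less_trans[OF ennreal_leI[OF that] assms(7)[folded r_def]] by (simp add: a_def)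
  have "continuous_on {0..r} (q_inv l a)"
  proof (rule q_inv_on_interval(1))
    show "continuous_on {0..} l" "\<And>s. s \<ge> 0 \<Longrightarrow> l s > 0"
      using assms(4) locally_lipschitz_on_imp_continuous_on by (auto simp: ell_smooth_def)
  qed (use tmax in \<open>auto simp: a_def\<close>)
  then have q_inv_int: "(q_inv l a has_integral integral {0..r} (q_inv l a)) {0..r}"
    by (intro integrable_integral integrable_continuous_real)
  have "\<phi> r - \<phi> 0 \<le> integral {0..r} (q_inv l a)"
  proof (rule has_integral_le[OF \<phi>_int q_inv_int])
    fix t assume t: "t \<in> {0..r}"
    have "\<phi>' t \<le> norm (gradient f (c t) - gradient f x)"
      unfolding \<phi>'_def using norm_cauchy_schwarz[of _ e] e by (metis mult.right_neutral)
    also have "\<dots> \<le> q_inv l a t"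
      unfolding a_def c_def
      by (rule gradient_change_le_q_inv[OF assms(4) e])
        (use t tmax dom in \<open>auto simp: a_def c_def\<close>)
    finally show "\<phi>' t \<le> q_inv l a t" .
  qed
  then have "F y \<le> F x + (gradient f x \<bullet> (y - x) + integral {0..r} (q_inv l a))"
    unfolding \<phi>_def ends re by simp
  then show ?thesis
    by (simp add: f_real assms(5,6) a_def r_def)
qed

end
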